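(* Let $X$ be a topological space, let $Y$ be a convex set in a real Hausdorff topological vector space, and let $f:X\times Y\to\mathbf{R}$. Assume that there is a function $\psi:Y\to\mathbf{R}$ such that the function $f+\psi$, i.e. $(x,y)\mapsto f(x,y)+\psi(y)$, belongs to $\mathcal{B}$ and $$\alpha_{f+\psi}<\beta_{f+\psi}.$$ Then, for every convex set $S\subseteq Y$ with $S\in\mathcal{C}_{f+\psi}$, for every bounded function $\varphi:X\to\mathbf{R}$ and for every $\lambda>0$ such that the function $\lambda f+\varphi$, i.e. $(x,y)\mapsto\lambda f(x,y)+\varphi(x)$, belongs to $\mathcal{A}_S$ and $$\lambda>\frac{2\sup_X|\varphi|}{\beta_{f+\psi}-\alpha_{f+\psi}},$$ there exists $y^*\in S$ such that the function $x\mapsto\lambda f(x,y^* )+\varphi(x)$ has at least two global minima in $X$.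
   Context: A function $h:X\to\mathbf{R}$ is inf-compact if $h^{-1}(]-\infty,r])$ is compact for all $r\in\mathbf{R}$. A function $k:Y\to\mathbf{R}$ is quasi-concave if $k^{-1}([r,+\infty[)$ is convex for all $r\in\mathbf{R}$. For a convex set $S\subseteq Y$, $\mathcal{A}_S$ denotes the class of all functions $g:X\times Y\to\mathbf{R}$ such that, for each $y\in S$, the function $g(\cdot,y)$ is lower semicontinuous and inf-compact. $\mathcal{B}$ denotes the class of all functions $g:X\times Y\to\mathbf{R}$ such that either, for each $x\in X$, the function $g(x,\cdot)$ is quasi-concave and continuous, or, for each $x\in X$, the function $g(x,\cdot)$ is concave. For $g:X\times Y\to\mathbf{R}$, put $\alpha_g=\sup_{y\in Y}\inf_{x\in X}g(x,y)$ and $\beta_g=\inf_{x\in X}\sup_{y\in Y}g(x,y)$. These are elements of $[-\infty,+\infty]$, and the usual rules of the extended real line are used (in particular, if $\beta_g-\alpha_g=+\infty$, a real number divided by it is $0$). $\mathcal{C}_g$ denotes the family of all sets $S\subseteq Y$ such that $\inf_{x\in X}\sup_{y\in S}g(x,y)=\inf_{x\in X}\sup_{y\in Y}g(x,y)$. "At least two global minima" means that there are at least two distinct points at which the function attains its global minimum. *)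

theory Defs
  imports "HOL-Analysis.Analysis"
begin

text \<open>Real topological vector spaces, not necessarily Hausdorff; the Hausdorff ones
  are the types of sort \<open>{real_tvs, t2_space}\<close>.  Continuity of negation is an axiom of
  \<open>topological_ab_group_add\<close>, but it is no extra demand, since it follows from continuity
  of scalar multiplication.\<close>

class real_tvs = real_vector + topological_ab_group_add +
  assumes tendsto_scaleR_Pair:
    "LIM p (nhds c \<times>\<^sub>F nhds x). fst p *\<^sub>R snd p :> nhds (c *\<^sub>R x)"

instance real_normed_vector \<subseteq> real_tvs
proof
  fix c :: real and x :: 'a
  show "LIM p (nhds c \<times>\<^sub>F nhds x). fst p *\<^sub>R snd p :> nhds (c *\<^sub>R x)"
    unfolding nhds_prod[symmetric]
    using tendsto_scaleR[OF tendsto_fst[OF filterlim_ident] tendsto_snd[OF filterlim_ident]]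
    by fastforce
qed

definition lower_semicont :: "('a::topological_space \<Rightarrow> real) \<Rightarrow> bool" where
  "lower_semicont h \<longleftrightarrow> (\<forall>x. \<forall>c < h x. \<forall>\<^sub>F z in nhds x. c < h z)"

definition inf_compact :: "('a::topological_space \<Rightarrow> real) \<Rightarrow> bool" where
  "inf_compact h \<longleftrightarrow> (\<forall>r. compact (h -` {..r}))"

definition quasi_concave_on :: "'b::real_vector set \<Rightarrow> ('b \<Rightarrow> real) \<Rightarrow> bool" where
  "quasi_concave_on Y k \<longleftrightarrow> (\<forall>r. convex {y \<in> Y. r \<le> k y})"

text \<open>The space \<open>X\<close> is a whole type, hence nonempty.  A function on \<open>X \<times> Y\<close> is a curried
  function \<open>g\<close>; its values \<open>g x y\<close> with \<open>y \<notin> Y\<close> are never used.\<close>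

definition class_A :: "'b set \<Rightarrow> ('a::topological_space \<Rightarrow> 'b \<Rightarrow> real) set" where
  "class_A S = {g. \<forall>y\<in>S. lower_semicont (\<lambda>x. g x y) \<and> inf_compact (\<lambda>x. g x y)}"

definition class_B ::
    "'b::{real_vector, topological_space} set \<Rightarrow> ('a \<Rightarrow> 'b \<Rightarrow> real) set" where
  "class_B Y = {g. (\<forall>x. quasi_concave_on Y (g x) \<and> continuous_on Y (g x))
                 \<or> (\<forall>x. concave_on Y (g x))}"

definition alpha :: "'b set \<Rightarrow> ('a \<Rightarrow> 'b \<Rightarrow> real) \<Rightarrow> ereal" where
  "alpha Y g = (SUP y\<in>Y. INF x. ereal (g x y))"

definition beta :: "'b set \<Rightarrow> ('a \<Rightarrow> 'b \<Rightarrow> real) \<Rightarrow> ereal" where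
  "beta Y g = (INF x. SUP y\<in>Y. ereal (g x y))"

definition family_C :: "'b set \<Rightarrow> ('a \<Rightarrow> 'b \<Rightarrow> real) \<Rightarrow> 'b set set" where
  "family_C Y g =
    {S. S \<subseteq> Y \<and> (INF x. SUP y\<in>S. ereal (g x y)) = (INF x. SUP y\<in>Y. ereal (g x y))}"

definition global_min :: "('a \<Rightarrow> real) \<Rightarrow> 'a \<Rightarrow> bool" where
  "global_min h x \<longleftrightarrow> (\<forall>z. h x \<le> h z)"

end

theory Submission
  imports Defs
begin

text \<open>If every \<open>\<lambda>x. l * f x y + \<phi> x\<close> with \<open>y \<in> S\<close> had a unique minimum, then
  \<open>g x y = f x y + \<psi> y + \<phi> x / l\<close> would satisfy the minimax equality on \<open>S\<close>; as
  \<open>\<phi> / l\<close> perturbs values by at most \<open>sup \<bar>\<phi>\<bar> / l\<close>, this gives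
  \<open>\<beta> - \<alpha> \<le> 2 * sup \<bar>\<phi>\<bar> / l\<close>, a contradiction.

  For the minimax equality, compactness reduces \<open>S\<close> to the hull of a finite set.  Let \<open>y0\<close>
  maximize \<open>v y = min\<^sub>x g x y\<close> there, with minimum point \<open>x0\<close>.  If \<open>g x0 y > v y0\<close>, then
  along the segment from \<open>y0\<close> to \<open>y\<close> the minimum points accumulate at some \<open>x\<close> with
  \<open>g x y0 \<le> v y0\<close> and \<open>g x y \<le> v y0\<close>: a second minimum point at \<open>y0\<close>.\<close>

section \<open>Sublevel sets and chains of compact sets\<close>

lemma closed_sublevel:
  assumes "lower_semicont h"
  shows "closed {x. h x \<le> c}"
proof -
  have "open {x. c < h x}"
  proof (subst open_subopen, intro ballI)
    fix x assume "x \<in> {x. c < h x}"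
    then have "\<forall>\<^sub>F z in nhds x. c < h z"
      using assms by (simp add: lower_semicont_def)
    then show "\<exists>T. open T \<and> x \<in> T \<and> T \<subseteq> {x. c < h x}"
      unfolding eventually_nhds by blast
  qed
  then show ?thesis
    by (simp add: closed_def Compl_eq not_le)
qed

lemma compact_sublevel:
  assumes "inf_compact h"
  shows "compact {x. h x \<le> c}"
  using assms by (simp add: inf_compact_def vimage_def atMost_def)

text \<open>Finitely many members of an increasing family meet in the one with the least index, so
  the finite intersection property applies inside one compact member. Closedness is stated apart
  from compactness because the space need not be Hausdorff.\<close>

lemma chain_fip:
  fixes K :: "real \<Rightarrow> 'a::topological_space set"
  assumes "I \<noteq> {}"
    and ne: "\<And>i. i \<in> I \<Longrightarrow> K i \<noteq> {}"
    and closed: "\<And>i. i \<in> I \<Longrightarrow> closed (K i)"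
    and compact: "\<And>i. i \<in> I \<Longrightarrow> compact (K i)"
    and mono: "\<And>i j. i \<in> I \<Longrightarrow> j \<in> I \<Longrightarrow> i \<le> j \<Longrightarrow> K i \<subseteq> K j"
  shows "\<exists>x. \<forall>i\<in>I. x \<in> K i"
proof -
  obtain i0 where i0: "i0 \<in> I"
    using \<open>I \<noteq> {}\<close> by blast
  have "K i0 \<inter> (\<Inter>i\<in>I. K i) \<noteq> {}"
  proof (rule compact_imp_fip_image)
    fix J
    assume J: "finite J" "J \<subseteq> I"
    have "Min (insert i0 J) \<in> I"
      using J i0 Min_in[of "insert i0 J"] by auto
    then obtain x where x: "x \<in> K (Min (insert i0 J))"
      using ne by blast
    have "x \<in> K j" if "j \<in> insert i0 J" for j
      using mono[of "Min (insert i0 J)" j] \<open>Min (insert i0 J) \<in> I\<close> J i0 that x by auto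
    then show "K i0 \<inter> (\<Inter>i\<in>J. K i) \<noteq> {}"
      by blast
  qed (use i0 closed compact in auto)
  then show ?thesis
    by blast
qed

text \<open>The sublevel sets at the attained values form a chain of nonempty closed compact sets;
  at a common point \<open>h\<close> is at most each of its values.\<close>

lemma global_min_exists:
  assumes "lower_semicont h" "inf_compact h"
  shows "\<exists>x. global_min h x"
proof -
  have "\<exists>x. \<forall>r\<in>range h. x \<in> {x. h x \<le> r}"
    by (rule chain_fip) (auto simp: closed_sublevel compact_sublevel assms)
  then show ?thesis
    by (auto simp: global_min_def)
qed

text \<open>Points \<open>s\<close> with \<open>h x s \<le> c < h x a\<close> propagate to the right by quasi-concavity, so the
  sets \<open>{x. \<forall>t\<in>{s..b}. h x t \<le> c}\<close> form a chain of nonempty compact sets.\<close>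

lemma segment_argument:
  fixes h :: "'a::topological_space \<Rightarrow> real \<Rightarrow> real"
  assumes "a < b"
    and closed: "\<And>s. a < s \<Longrightarrow> s \<le> b \<Longrightarrow> closed {x. h x s \<le> c}"
    and compact: "\<And>s. a < s \<Longrightarrow> s \<le> b \<Longrightarrow> compact {x. h x s \<le> c}"
    and qc: "\<And>x s t. a \<le> s \<Longrightarrow> s \<le> t \<Longrightarrow> t \<le> b \<Longrightarrow> min (h x a) (h x t) \<le> h x s"
    and lim: "\<And>x. (\<And>s. a < s \<Longrightarrow> s \<le> b \<Longrightarrow> h x s \<le> c) \<Longrightarrow> h x a \<le> c"
    and ex: "\<And>s. a < s \<Longrightarrow> s \<le> b \<Longrightarrow> \<exists>x. h x s \<le> c \<and> c < h x a"
  shows "\<exists>x. h x a \<le> c \<and> h x b \<le> c"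
proof -
  define K where "K s = (\<Inter>t\<in>{s..b}. {x. h x t \<le> c})" for s
  have "\<exists>x. \<forall>s\<in>{a<..b}. x \<in> K s"
  proof (rule chain_fip)
    fix s assume s: "s \<in> {a<..b}"
    obtain x where x: "h x s \<le> c" "c < h x a"
      using ex[of s] s greaterThanAtMost_iff by blast
    have "h x t \<le> c" if "t \<in> {s..b}" for t
      using qc[of s t x] s that x by auto
    then have "x \<in> K s"
      by (auto simp: K_def)
    then show "K s \<noteq> {}" by blast
    show "closed (K s)"
      unfolding K_def using s by (intro closed_INT ballI closed) auto
    moreover have "K s = {x. h x s \<le> c} \<inter> K s"
      using s by (auto simp: K_def)
    ultimately show "compact (K s)"
      using compact_Int_closed[OF compact[of s] \<open>closed (K s)\<close>] s by simp
  qed (use \<open>a < b\<close> in \<open>auto simp: K_def\<close>)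
  then obtain x where x: "\<forall>s\<in>{a<..b}. x \<in> K s" by blast
  \<comment> \<open>The common point satisfies the bound on the half-open interval;
    \<open>lim\<close> then adds the left end.\<close>
  have "h x s \<le> c" if "a < s" "s \<le> b" for s
    using x that by (auto simp: K_def)
  then show ?thesis
    using lim[of x] \<open>a < b\<close> by fastforce
qed

section \<open>Barycentric coordinates on the hull of a finite set\<close>

text \<open>The standard simplex on \<open>F\<close>, realised by functions on the whole type that
  vanish off \<open>F\<close>. It thus inherits the product topology of the function space, whatever
  topology the vectors may carry.\<close>

definition weights :: "'b set \<Rightarrow> ('b \<Rightarrow> real) set" where
  "weights F = {t. (\<forall>y. 0 \<le> t y) \<and> (\<forall>y. y \<notin> F \<longrightarrow> t y = 0) \<and> sum t F = 1}"

definition barycenter :: "'b::real_vector set \<Rightarrow> ('b \<Rightarrow> real) \<Rightarrow> 'b" where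
  "barycenter F t = (\<Sum>y\<in>F. t y *\<^sub>R y)"

lemma convex_hull_eq_barycenter:
  assumes "finite F"
  shows "convex hull F = barycenter F ` weights F"
proof
  show "convex hull F \<subseteq> barycenter F ` weights F"
  proof
    fix y assume "y \<in> convex hull F"
    then obtain u where u: "\<forall>x\<in>F. 0 \<le> u x" "sum u F = 1" "(\<Sum>x\<in>F. u x *\<^sub>R x) = y"
      by (auto simp: convex_hull_finite[OF assms])
    define t where "t x = (if x \<in> F then u x else 0)" for x
    have "sum t F = sum u F" "(\<Sum>x\<in>F. t x *\<^sub>R x) = (\<Sum>x\<in>F. u x *\<^sub>R x)"
      by (auto simp: t_def intro!: sum.cong)
    then have "t \<in> weights F" "y = barycenter F t"
      using u by (auto simp: weights_def barycenter_def t_def)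
    then show "y \<in> barycenter F ` weights F" by blast
  qed
qed (auto simp: convex_hull_finite[OF assms] weights_def barycenter_def)

lemma weights_le_1:
  assumes "finite F" "t \<in> weights F"
  shows "t y \<le> 1"
proof (cases "y \<in> F")
  case True
  then have "t y \<le> sum t F"
    using assms by (intro member_le_sum) (auto simp: weights_def)
  then show ?thesis using assms by (auto simp: weights_def)
qed (use assms in \<open>auto simp: weights_def\<close>)

text \<open>By Tychonoff the product of \<open>{0..1}\<close> over \<open>F\<close> and
  \<open>{0}\<close> elsewhere is compact; the simplex is its closed slice where the coordinates
  over \<open>F\<close> sum to \<open>1\<close>.\<close>

lemma compact_weights:
  assumes "finite F"
  shows "compact (weights F)"
proof -
  define B where "B = (\<lambda>y. if y \<in> F then {0..1} else {0::real})"
  have "compactin (product_topology (\<lambda>i. euclidean) UNIV) (PiE UNIV B)"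
    unfolding compactin_PiE by (auto simp: B_def)
  then have "compact (Pi UNIV B)"
    by (simp add: euclidean_product_topology PiE_UNIV_domain)
  moreover have "closed {t. sum t F = (1::real)}"
    by (intro closed_Collect_eq continuous_intros
        continuous_on_product_coordinates)
  moreover have "weights F = Pi UNIV B \<inter> {t. sum t F = 1}"
    using weights_le_1[OF assms]
    by (fastforce simp: weights_def B_def Pi_iff split: if_splits)
  ultimately show ?thesis
    by (metis compact_Int_closed)
qed

lemma closed_weights: "closed (weights F)"
  unfolding weights_def Collect_conj_eq
  by (intro closed_Int closed_Collect_all closed_Collect_imp closed_Collect_le closed_Collect_eq
      open_Collect_const continuous_intros continuous_on_product_coordinates)

lemma weights_segment:
  assumes "t \<in> weights F" "u \<in> weights F" "0 \<le> s" "s \<le> 1"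
  shows "(\<lambda>y. t y + s * (u y - t y)) \<in> weights F"
proof -
  have "t y + s * (u y - t y) = (1 - s) * t y + s * u y" for y
    by (simp add: algebra_simps)
  moreover have "0 \<le> (1 - s) * t y + s * u y" for y
    using assms by (auto simp: weights_def)
  ultimately show ?thesis
    using assms by (auto simp: weights_def sum.distrib simp flip: sum_distrib_left)
qed

lemma barycenter_segment:
  "barycenter F (\<lambda>y. t y + s * (u y - t y)) =
    barycenter F t + s *\<^sub>R (barycenter F u - barycenter F t)"
  by (simp add: barycenter_def algebra_simps sum.distrib sum_subtractf scaleR_sum_right)

section \<open>Quasi-concave and concave functions\<close>

lemma quasi_concave_onD:
  assumes "quasi_concave_on C k" "y \<in> C" "z \<in> C" "0 \<le> s" "s \<le> 1"
  shows "min (k y) (k z) \<le> k (y + s *\<^sub>R (z - y))"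
proof -
  have "convex {w \<in> C. min (k y) (k z) \<le> k w}"
    using assms(1) by (auto simp: quasi_concave_on_def)
  from convexD_alt[OF this, of y z s] assms show ?thesis
    by (auto simp: algebra_simps)
qed

lemma quasi_concave_on_subset:
  assumes "quasi_concave_on Y k" "convex C" "C \<subseteq> Y"
  shows "quasi_concave_on C k"
proof -
  have "{y \<in> C. r \<le> k y} = C \<inter> {y \<in> Y. r \<le> k y}" for r
    using assms(3) by auto
  then show ?thesis
    using assms by (auto simp: quasi_concave_on_def intro!: convex_Int)
qed

lemma concave_imp_quasi_concave:
  assumes "concave_on C k"
  shows "quasi_concave_on C k"
  unfolding quasi_concave_on_def convex_alt
proof (intro allI ballI impI)
  fix r y z and u :: real
  assume y: "y \<in> {y \<in> C. r \<le> k y}" and z: "z \<in> {y \<in> C. r \<le> k y}" and u: "0 \<le> u \<and> u \<le> 1"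
  have "(1 - u) * r + u * r \<le> (1 - u) * k y + u * k z"
    using y z u by (intro add_mono mult_left_mono) auto
  also have "\<dots> \<le> k ((1 - u) *\<^sub>R y + u *\<^sub>R z)"
    using assms y z u by (auto simp: concave_on_iff)
  finally have "r \<le> k ((1 - u) *\<^sub>R y + u *\<^sub>R z)" by (simp add: algebra_simps)
  moreover have "(1 - u) *\<^sub>R y + u *\<^sub>R z \<in> C"
    using assms y z u by (auto simp: concave_on_iff convex_alt)
  ultimately show "(1 - u) *\<^sub>R y + u *\<^sub>R z \<in> {y \<in> C. r \<le> k y}" by blast
qed

section \<open>Maximin points and saddle points\<close>

text \<open>The minimum value \<open>v t\<close> over \<open>x\<close> is an infimum of continuous
  functions, hence upper semicontinuous, and attains its maximum \<open>c\<close> on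
  \<open>T\<close>. In terms of intersections: the sets where \<open>G x\<close> is at least
  \<open>v u\<close>, indexed by the pairs \<open>(x, u)\<close>, have a common point, since for
  finitely many pairs the \<open>u\<close> with the largest \<open>v u\<close> lies in all of
  them.\<close>

lemma maximin_attained:
  fixes G :: "'a \<Rightarrow> 'c::topological_space \<Rightarrow> real"
  assumes "compact T" "T \<noteq> {}"
    and cont: "\<And>x. continuous_on T (G x)"
    and closed: "closed T"
    and bdd: "\<And>t. t \<in> T \<Longrightarrow> \<exists>x. \<forall>z. G x t \<le> G z t"
  shows "\<exists>t\<in>T. \<exists>c. (\<forall>x. c \<le> G x t) \<and> (\<forall>u\<in>T. \<exists>x. G x u \<le> c)"
proof -
  obtain m where m: "\<And>t z. t \<in> T \<Longrightarrow> G (m t) t \<le> G z t"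
    using bdd by metis
  define v where "v t = G (m t) t" for t
  have "T \<inter> (\<Inter>i\<in>UNIV \<times> T. T \<inter> G (fst i) -` {v (snd i)..}) \<noteq> {}"
  proof (rule compact_imp_fip_image)
    fix J :: "('a \<times> 'c) set"
    assume J: "finite J" "J \<subseteq> UNIV \<times> T"
    show "T \<inter> (\<Inter>i\<in>J. T \<inter> G (fst i) -` {v (snd i)..}) \<noteq> {}"
    proof (cases "J = {}")
      case False
      then have "Max (v ` snd ` J) \<in> v ` snd ` J"
        using J by (intro Max_in) auto
      then obtain u where u: "u \<in> snd ` J" "v u = Max (v ` snd ` J)"
        by (metis imageE)
      then have "u \<in> T" using J by auto
      have "v (snd i) \<le> G (fst i) u" if "i \<in> J" for i
      proof -
        have "v (snd i) \<le> v u" using that J u by auto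
        also have "\<dots> \<le> G (fst i) u" using m[OF \<open>u \<in> T\<close>] by (simp add: v_def)
        finally show ?thesis .
      qed
      with \<open>u \<in> T\<close> show ?thesis by auto
    qed (use assms in auto)
  next
    fix i assume "i \<in> (UNIV :: 'a set) \<times> T"
    show "closed (T \<inter> G (fst i) -` {v (snd i)..})"
      using cont closed by (intro continuous_closed_preimage) auto
  qed (rule assms)
  then obtain t where t: "t \<in> T" "t \<in> (\<Inter>i\<in>UNIV \<times> T. T \<inter> G (fst i) -` {v (snd i)..})"
    by blast
  have "v u \<le> G x t" if "u \<in> T" for x u
    using INT_D[OF t(2), of "(x, u)"] that by simp
  then show ?thesis
    using t(1) unfolding v_def by blast
qed

text \<open>The maximin point and its unique minimum point form the saddle point. Continuity is
  required in the weights, not in the points, so that concave functions on a hull without topology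
  are covered as well.\<close>

lemma saddle_point:
  fixes g :: "'a::topological_space \<Rightarrow> 'b::real_vector \<Rightarrow> real"
  assumes F: "finite F" "F \<noteq> {}"
    and qc: "\<And>x. quasi_concave_on (convex hull F) (g x)"
    and cont: "\<And>x. continuous_on (weights F) (\<lambda>t. g x (barycenter F t))"
    and lsc: "\<And>y. y \<in> convex hull F \<Longrightarrow> lower_semicont (\<lambda>x. g x y)"
    and inf_comp: "\<And>y. y \<in> convex hull F \<Longrightarrow> inf_compact (\<lambda>x. g x y)"
    and unique: "\<And>y x z. y \<in> convex hull F \<Longrightarrow> global_min (\<lambda>x. g x y) x \<Longrightarrow>
      global_min (\<lambda>x. g x y) z \<Longrightarrow> x = z"
  shows "\<exists>x. \<exists>y0\<in>convex hull F.
    (\<forall>y\<in>convex hull F. g x y \<le> g x y0) \<and> (\<forall>z. g x y0 \<le> g z y0)"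
proof -
  note hull = convex_hull_eq_barycenter[OF F(1)]
  have "\<exists>t\<in>weights F. \<exists>c. (\<forall>x. c \<le> g x (barycenter F t)) \<and>
    (\<forall>u\<in>weights F. \<exists>x. g x (barycenter F u) \<le> c)"
  proof (rule maximin_attained)
    show "weights F \<noteq> {}"
      using F hull by auto
    fix t assume "t \<in> weights F"
    then have "barycenter F t \<in> convex hull F"
      using hull by blast
    then show "\<exists>x. \<forall>z. g x (barycenter F t) \<le> g z (barycenter F t)"
      using global_min_exists[OF lsc inf_comp] unfolding global_min_def by blast
  qed (use cont F in \<open>simp_all add: compact_weights closed_weights\<close>)
  then obtain t0 c where t0: "t0 \<in> weights F" and c_le: "\<And>x. c \<le> g x (barycenter F t0)"
    and c_ex: "\<And>u. u \<in> weights F \<Longrightarrow> \<exists>x. g x (barycenter F u) \<le> c" by blast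
  define y0 where "y0 = barycenter F t0"
  have y0: "y0 \<in> convex hull F"
    using t0 hull by (auto simp: y0_def)
  obtain x0 where x0: "g x0 y0 \<le> c"
    using c_ex[OF t0] by (auto simp: y0_def)
  have "g x0 y \<le> c" if y: "y \<in> convex hull F" for y
  proof (rule ccontr)
    assume "\<not> g x0 y \<le> c"
    obtain t1 where t1: "t1 \<in> weights F" "y = barycenter F t1"
      using y hull by auto
    define h where "h x s = g x (y0 + s *\<^sub>R (y - y0))" for x s
    have seg: "y0 + s *\<^sub>R (y - y0) \<in> convex hull F" if "0 \<le> s" "s \<le> 1" for s
      using convexD_alt[OF convex_convex_hull y0 \<open>y \<in> convex hull F\<close> that]
      by (simp add: algebra_simps)
    have h_cont: "continuous_on {0..1} (h x)" for x
    proof -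
      \<comment> \<open>The segment from \<open>y0\<close> to \<open>y\<close> is lifted to the
        segment of weights from \<open>t0\<close> to \<open>t1\<close>, where \<open>cont\<close>
        applies.\<close>
      have "continuous_on {0..1} (\<lambda>s. g x (barycenter F (\<lambda>y. t0 y + s * (t1 y - t0 y))))"
        by (rule continuous_on_compose2[OF cont])
          (auto intro!: continuous_intros weights_segment t0 t1)
      then show ?thesis
        by (simp add: h_def y0_def t1(2) barycenter_segment)
    qed
    have h_qc: "min (h x a) (h x b) \<le> h x s" if "0 \<le> a" "a \<le> s" "s \<le> b" "b \<le> 1" for x a s b
    proof (cases "a = b")
      case False
      define r where "r = (s - a) / (b - a)"
      have r: "0 \<le> r" "r \<le> 1"
        using that False by (auto simp: r_def field_simps)
      have "y0 + a *\<^sub>R (y - y0) + r *\<^sub>R ((y0 + b *\<^sub>R (y - y0)) - (y0 + a *\<^sub>R (y - y0)))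
        = y0 + (a + r * (b - a)) *\<^sub>R (y - y0)"
        by (simp add: algebra_simps)
      also have "a + r * (b - a) = s"
        using False by (simp add: r_def)
      finally have eq: "y0 + a *\<^sub>R (y - y0) + r *\<^sub>R ((y0 + b *\<^sub>R (y - y0)) - (y0 + a *\<^sub>R (y - y0)))
        = y0 + s *\<^sub>R (y - y0)" .
      show ?thesis
        using quasi_concave_onD[OF qc seg[of a] seg[of b] r, of x, unfolded eq] that
        by (simp add: h_def)
    qed (use that in auto)
    have h_ex: "\<exists>x. h x s \<le> c" if s: "0 \<le> s" "s \<le> 1" for s
    proof -
      obtain t where "t \<in> weights F" "y0 + s *\<^sub>R (y - y0) = barycenter F t"
        using seg[OF s] hull by auto
      then show ?thesis
        using c_ex by (auto simp: h_def)
    qed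
    \<comment> \<open>The parameters at which \<open>x0\<close> is still a minimum point with value
      \<open>c\<close>. The argument starts from the last one, \<open>a\<close>, so that beyond
      \<open>a\<close> other points must take over.\<close>
    define A where "A = {s \<in> {0..1}. h x0 s \<le> c} \<inter> (\<Inter>x. {s \<in> {0..1}. c \<le> h x s})"
    have "closed A"
      unfolding A_def
      by (intro closed_Int closed_INT ballI continuous_on_closed_Collect_le h_cont
          continuous_on_const closed_atLeastAtMost)
    moreover have "A \<subseteq> {0..1}" "0 \<in> A"
      using x0 c_le by (auto simp: A_def h_def y0_def)
    ultimately obtain a where "a \<in> A" and a_max: "\<And>s. s \<in> A \<Longrightarrow> s \<le> a"
      using compact_attains_sup[of A] compact_Int_closed[of "{0..1}" A]
      by (metis compact_Icc empty_iff inf.absorb2)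
    then have a: "0 \<le> a" "a \<le> 1" "h x0 a \<le> c" "\<And>x. c \<le> h x a"
      by (auto simp: A_def)
    have x0_1: "c < h x0 1"
      using \<open>\<not> g x0 y \<le> c\<close> by (simp add: h_def)
    with a have "a < 1" by (cases "a = 1") auto
    have a_unique: "x = x0" if "h x a \<le> c" for x
    proof -
      have "h x a \<le> h z a" "h x0 a \<le> h z a" for z
        using a(3) a(4)[of z] that by auto
      then show ?thesis
        using unique[OF seg[OF a(1,2)], of x x0] by (simp add: global_min_def h_def)
    qed
    have "\<exists>x. h x a \<le> c \<and> h x 1 \<le> c"
    proof (rule segment_argument[OF \<open>a < 1\<close>])
      fix s assume s: "a < s" "s \<le> 1"
      have "y0 + s *\<^sub>R (y - y0) \<in> convex hull F"
        using seg s a(1) by simp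
      from closed_sublevel[OF lsc[OF this]] compact_sublevel[OF inf_comp[OF this]]
      show "closed {x. h x s \<le> c}" "compact {x. h x s \<le> c}"
        by (simp_all add: h_def)
      show "\<exists>x. h x s \<le> c \<and> c < h x a"
      \<comment> \<open>Otherwise \<open>x0\<close> would be the only point with value at most
        \<open>c\<close> at \<open>s\<close>. Quasi-concavity between \<open>a\<close> and
        \<open>1\<close> gives \<open>h x0 s\<close> at least \<open>c\<close>, so \<open>s\<close>
        would belong to \<open>A\<close>, although \<open>a\<close> is its maximum.\<close>
      proof (rule ccontr)
        assume "\<not> ?thesis"
        then have *: "x = x0" if "h x s \<le> c" for x
          using a_unique[of x] that by (meson not_le)
        obtain x where "h x s \<le> c"
          using h_ex[of s] s a(1) by auto
        with * have x0_s: "h x0 s \<le> c" by blast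
        have "c \<le> h x0 s"
          using h_qc[of a s 1 x0] a x0_1 s a(4)[of x0] by auto
        then have "c \<le> h x s" for x
          using *[of x] by (cases "h x s \<le> c") auto
        with x0_s s a have "s \<in> A" by (auto simp: A_def)
        with a_max s show False by fastforce
      qed
    next
      fix x assume le: "\<And>s. a < s \<Longrightarrow> s \<le> 1 \<Longrightarrow> h x s \<le> c"
      have "continuous_on {a..1} (h x)"
        using h_cont by (rule continuous_on_subset) (use a in auto)
      then have "(h x \<longlongrightarrow> h x a) (at a within {a..1})"
        using \<open>a < 1\<close> by (simp add: continuous_on_def)
      then have lim: "(h x \<longlongrightarrow> h x a) (at_right a)"
        using \<open>a < 1\<close> by (simp add: at_within_Icc_at_right)
      moreover have "\<forall>\<^sub>F s in at_right a. h x s \<le> c"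
        using eventually_at_right_real[OF \<open>a < 1\<close>] by eventually_elim (use le in auto)
      ultimately show "h x a \<le> c"
        by (intro tendsto_upperbound[OF lim]) auto
    qed (use h_qc a in auto)
    \<comment> \<open>The point found is a minimum point at \<open>a\<close>, hence
      \<open>x0\<close>; but \<open>x0\<close> exceeds \<open>c\<close> at \<open>1\<close>.\<close>
    with a_unique x0_1 show False by force
  qed
  moreover have "g x0 y0 = c"
    using x0 c_le[of x0] by (simp add: y0_def)
  ultimately show ?thesis
    using y0 c_le by (auto simp: y0_def)
qed

section \<open>Continuity of concave functions in interior weights\<close>

text \<open>The weight \<open>u\<close> is a convex combination of \<open>w\<close> and a further
  weight \<open>q\<close>, with coefficient \<open>r\<close> at \<open>q\<close>. Concavity gives
  the estimate, because a lower bound \<open>m\<close> at the vertices holds on the whole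
  hull.\<close>

lemma concave_lower_estimate:
  assumes F: "finite F" and k: "concave_on (convex hull F) k"
    and u: "u \<in> weights F" and w: "w \<in> weights F"
    and d: "0 < d" "\<And>y. y \<in> F \<Longrightarrow> d \<le> w y"
    and m: "\<And>y. y \<in> F \<Longrightarrow> m \<le> k y"
    and r: "r = (\<Sum>y\<in>F. \<bar>u y - w y\<bar>) / d" "r \<le> 1"
  shows "(1 - r) * k (barycenter F w) + r * m \<le> k (barycenter F u)"
proof (cases "r = 0")
  case True
  then have "u y = w y" if "y \<in> F" for y
    using r(1) d(1) F that by (simp add: sum_nonneg_eq_0_iff)
  then show ?thesis
    using True by (simp add: barycenter_def)
next
  case False
  have "0 \<le> r"
    using r d by (simp add: sum_nonneg)
  with False have "0 < r" by simp
  \<comment> \<open>The ray from \<open>w\<close> through \<open>u\<close> is prolonged by the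
    factor \<open>1 / r\<close>. By the choice of \<open>r\<close> no coordinate moves by more than
    \<open>d\<close>, so \<open>q\<close> stays in the simplex.\<close>
  define q where "q y = w y + (u y - w y) / r" for y
  have q_nonneg: "0 \<le> q y" if "y \<in> F" for y
  proof -
    have "\<bar>u y - w y\<bar> \<le> (\<Sum>y\<in>F. \<bar>u y - w y\<bar>)"
      using F that by (intro member_le_sum) auto
    also have "\<dots> = r * d" using r d by simp
    also have "\<dots> \<le> r * w y"
      using d(2)[OF that] \<open>0 < r\<close> by simp
    finally show ?thesis
      using \<open>0 < r\<close> by (simp add: q_def field_simps abs_le_iff)
  qed
  have q_sum: "sum q F = 1"
    using u w by (simp add: q_def weights_def sum.distrib sum_subtractf flip: sum_divide_distrib)
  have q_0: "q y = 0" if "y \<notin> F" for y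
    using u w that by (simp add: q_def weights_def)
  have "0 \<le> q y" for y
    using q_nonneg[of y] q_0[of y] by (cases "y \<in> F") auto
  then have q: "q \<in> weights F"
    using q_sum q_0 by (simp add: weights_def)
  have "barycenter F u = (1 - r) *\<^sub>R barycenter F w + r *\<^sub>R barycenter F q"
  proof -
    have "u y = (1 - r) * w y + r * q y" for y
      using \<open>0 < r\<close> by (simp add: q_def field_simps)
    then show ?thesis
      by (simp add: barycenter_def scaleR_sum_right scaleR_left.add sum.distrib)
  qed
  moreover have bw: "barycenter F w \<in> convex hull F" and bq: "barycenter F q \<in> convex hull F"
    using w q convex_hull_eq_barycenter[OF F] by auto
  ultimately have "(1 - r) * k (barycenter F w) + r * k (barycenter F q) \<le> k (barycenter F u)"
    using k r(2) \<open>0 \<le> r\<close> by (simp add: concave_on_iff)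
  moreover have "m \<le> k (barycenter F q)"
    using convex_on_convex_hull_bound[of F "\<lambda>y. - k y" "- m"] k m bq
    by (auto simp: concave_on_def)
  then have "r * m \<le> r * k (barycenter F q)"
    using \<open>0 \<le> r\<close> by (rule mult_left_mono)
  ultimately show ?thesis by linarith
qed

text \<open>All coordinates of both weights are at least \<open>d\<close>, so the lower estimate
  applies with the roles exchanged too. This traps the nearby values between two bounds that tend to
  the value at \<open>u\<close>.\<close>

lemma concave_continuous_on_interior_weights:
  assumes F: "finite F" and k: "concave_on (convex hull F) k" and d: "0 < d"
  shows "continuous_on {t \<in> weights F. \<forall>y\<in>F. d \<le> t y} (\<lambda>t. k (barycenter F t))"
    (is "continuous_on ?W ?k")
  unfolding continuous_on_def
proof
  fix u assume u: "u \<in> ?W"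
  define r where "r w = (\<Sum>y\<in>F. \<bar>w y - u y\<bar>) / d" for w
  define m where "m = Min (k ` F)"
  have m: "m \<le> k y" if "y \<in> F" for y
    using F that by (simp add: m_def)
  have coord: "((\<lambda>w. w y) \<longlongrightarrow> u y) (at u within ?W)" for y
    using continuous_on_subset[OF continuous_on_product_coordinates[of y], of ?W] u
    unfolding continuous_on_def by auto
  have "(r \<longlongrightarrow> (\<Sum>y\<in>F. \<bar>u y - u y\<bar>) / d) (at u within ?W)"
    unfolding r_def using d by (intro tendsto_intros coord) auto
  then have r0: "(r \<longlongrightarrow> 0) (at u within ?W)" by simp
  then have ev: "\<forall>\<^sub>F w in at u within ?W. r w < 1"
    by (rule order_tendstoD) simp
  have ev': "\<forall>\<^sub>F w in at u within ?W. w \<in> ?W"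
    by (simp add: eventually_at_filter)
  show "(?k \<longlongrightarrow> ?k u) (at u within ?W)"
  proof (rule tendsto_sandwich)
    show "\<forall>\<^sub>F w in at u within ?W. (1 - r w) * ?k u + r w * m \<le> ?k w"
      using ev ev'
    proof eventually_elim
      case (elim w)
      then show ?case
        using u by (intro concave_lower_estimate[OF F k _ _ d]) (auto simp: r_def m)
    qed
    \<comment> \<open>This is the estimate centred at \<open>w\<close>, solved for the value at
      \<open>w\<close>; the division uses \<open>r w < 1\<close>.\<close>
    show "\<forall>\<^sub>F w in at u within ?W. ?k w \<le> (?k u - r w * m) / (1 - r w)"
      using ev ev'
    proof eventually_elim
      case (elim w)
      then have "(1 - r w) * ?k w + r w * m \<le> ?k u"
        using u by (intro concave_lower_estimate[OF F k _ _ d])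
          (auto simp: r_def m abs_minus_commute)
      then show ?case
        using elim by (simp add: pos_le_divide_eq algebra_simps)
    qed
    have "((\<lambda>w. (1 - r w) * ?k u + r w * m) \<longlongrightarrow> (1 - 0) * ?k u + 0 * m) (at u within ?W)"
      by (intro tendsto_intros r0)
    then show "((\<lambda>w. (1 - r w) * ?k u + r w * m) \<longlongrightarrow> ?k u) (at u within ?W)" by simp
    have "((\<lambda>w. (?k u - r w * m) / (1 - r w)) \<longlongrightarrow> (?k u - 0 * m) / (1 - 0)) (at u within ?W)"
      by (intro tendsto_intros r0) auto
    then show "((\<lambda>w. (?k u - r w * m) / (1 - r w)) \<longlongrightarrow> ?k u) (at u within ?W)" by simp
  qed
qed

section \<open>Minimax on the hull of a finite set\<close>

text \<open>At a saddle point the value is both the largest over the hull and the minimum for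
  \<open>y0\<close>, and the latter is at most \<open>c\<close>.\<close>

lemma finite_minimax_continuous:
  fixes g :: "'a::topological_space \<Rightarrow> 'b::real_vector \<Rightarrow> real"
  assumes F: "finite F" "F \<noteq> {}"
    and qc: "\<And>x. quasi_concave_on (convex hull F) (g x)"
    and cont: "\<And>x. continuous_on (weights F) (\<lambda>t. g x (barycenter F t))"
    and lsc: "\<And>y. y \<in> convex hull F \<Longrightarrow> lower_semicont (\<lambda>x. g x y)"
    and inf_comp: "\<And>y. y \<in> convex hull F \<Longrightarrow> inf_compact (\<lambda>x. g x y)"
    and unique: "\<And>y x z. y \<in> convex hull F \<Longrightarrow> global_min (\<lambda>x. g x y) x \<Longrightarrow>
      global_min (\<lambda>x. g x y) z \<Longrightarrow> x = z"
    and le: "\<And>y. y \<in> convex hull F \<Longrightarrow> \<exists>x. g x y \<le> c"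
  shows "\<exists>x. \<forall>y\<in>convex hull F. g x y \<le> c"
proof -
  have "\<exists>x. \<exists>y0\<in>convex hull F.
      (\<forall>y\<in>convex hull F. g x y \<le> g x y0) \<and> (\<forall>z. g x y0 \<le> g z y0)"
    using F qc cont lsc inf_comp unique by (rule saddle_point)
  then obtain x y0 where x: "y0 \<in> convex hull F" "\<forall>y\<in>convex hull F. g x y \<le> g x y0"
    "\<forall>z. g x y0 \<le> g z y0" by blast
  have "g x y0 \<le> c"
    using le[OF x(1)] x(3) order_trans by blast
  then show ?thesis
    using x(2) order_trans by blast
qed

text \<open>Concave functions may fail to be upper semicontinuous at the boundary of the hull, so
  they are first restricted to the homothetic copies \<open>(1 - e) *\<^sub>R F + e *\<^sub>R b\<close> around the
  barycentre \<open>b\<close>; compactness permits letting \<open>e\<close> tend to \<open>0\<close>.\<close>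

lemma finite_minimax_concave:
  fixes g :: "'a::topological_space \<Rightarrow> 'b::real_vector \<Rightarrow> real"
  assumes F: "finite F" "F \<noteq> {}"
    and conc: "\<And>x. concave_on (convex hull F) (g x)"
    and lsc: "\<And>y. y \<in> convex hull F \<Longrightarrow> lower_semicont (\<lambda>x. g x y)"
    and inf_comp: "\<And>y. y \<in> convex hull F \<Longrightarrow> inf_compact (\<lambda>x. g x y)"
    and unique: "\<And>y x z. y \<in> convex hull F \<Longrightarrow> global_min (\<lambda>x. g x y) x \<Longrightarrow>
      global_min (\<lambda>x. g x y) z \<Longrightarrow> x = z"
    and le: "\<And>y. y \<in> convex hull F \<Longrightarrow> \<exists>x. g x y \<le> c"
  shows "\<exists>x. \<forall>y\<in>convex hull F. g x y \<le> c"
proof -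
  \<comment> \<open>Uniform weights: all their coordinates on \<open>F\<close> are positive, which
    makes \<open>b\<close> a suitable centre.\<close>
  define w where "w y = (if y \<in> F then 1 / real (card F) else 0)" for y
  define b where "b = barycenter F w"
  have n: "real (card F) > 0"
    using F by (simp add: card_gt_0_iff)
  then have w: "w \<in> weights F"
    using F by (simp add: w_def weights_def)
  then have b: "b \<in> convex hull F"
    using convex_hull_eq_barycenter[OF F(1)] by (simp add: b_def)
  define p where "p e y = (1 - e) *\<^sub>R y + e *\<^sub>R b" for e y
  have p: "p e y \<in> convex hull F" if "0 < e" "e < 1" "y \<in> convex hull F" for e y
    unfolding p_def using convexD_alt[OF convex_convex_hull that(3) b] that by simp
  have pp: "p e ((1 - u) *\<^sub>R y + u *\<^sub>R z) = (1 - u) *\<^sub>R p e y + u *\<^sub>R p e z" for e u y z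
    by (simp add: p_def algebra_simps)
  have conc_p: "concave_on (convex hull F) (\<lambda>y. g x (p e y))" if e: "0 < e" "e < 1" for x e
    unfolding concave_on_iff
  proof (intro conjI ballI allI impI)
    fix y z u v
    assume y: "y \<in> convex hull F" and z: "z \<in> convex hull F"
      and uv: "0 \<le> u" "0 \<le> v" "u + v = (1::real)"
    have "1 - v = u" using uv by simp
    show "u * g x (p e y) + v * g x (p e z) \<le> g x (p e (u *\<^sub>R y + v *\<^sub>R z))"
      unfolding pp[of e v y z, unfolded \<open>1 - v = u\<close>]
      using conc[of x] p[OF e y] p[OF e z] uv by (simp add: concave_on_iff)
  qed (rule convex_convex_hull)
  have cont_p: "continuous_on (weights F) (\<lambda>t. g x (p e (barycenter F t)))"
    if e: "0 < e" "e < 1" for x e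
  proof -
    \<comment> \<open>Mixing a weight with \<open>w\<close> in proportion \<open>e\<close> leaves
      every coordinate on \<open>F\<close> at least \<open>e / real (card F)\<close>, where concave
      functions are continuous.\<close>
    let ?W = "{t \<in> weights F. \<forall>y\<in>F. e / real (card F) \<le> t y}"
    have shrink: "continuous_on (weights F) (\<lambda>t y. t y + e * (w y - t y))"
      by (intro continuous_intros continuous_on_subset[OF continuous_on_product_coordinates]) auto
    have inner: "continuous_on ?W (\<lambda>t. g x (barycenter F t))"
      using e n by (intro concave_continuous_on_interior_weights F conc) auto
    have maps: "(\<lambda>t y. t y + e * (w y - t y)) ` weights F \<subseteq> ?W"
    proof
      fix u assume "u \<in> (\<lambda>t y. t y + e * (w y - t y)) ` weights F"
      then obtain t where t: "t \<in> weights F" "u = (\<lambda>y. t y + e * (w y - t y))" by blast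
      have "e / real (card F) \<le> u y" if "y \<in> F" for y
      proof -
        have "0 \<le> (1 - e) * t y"
          using t e by (simp add: weights_def)
        then show ?thesis
          using that t(2) by (simp add: w_def algebra_simps)
      qed
      then show "u \<in> ?W"
        using weights_segment[OF t(1) w, of e] e t(2) by auto
    qed
    have "continuous_on (weights F)
        (\<lambda>t. g x (barycenter F (\<lambda>y. t y + e * (w y - t y))))"
      by (rule continuous_on_compose2[OF inner shrink maps])
    moreover have "barycenter F (\<lambda>y. t y + e * (w y - t y)) = p e (barycenter F t)" for t
      unfolding barycenter_segment p_def b_def by (simp add: algebra_simps)
    ultimately show ?thesis by simp
  qed
  define K where "K e = (\<Inter>y\<in>convex hull F. {x. g x (p e y) \<le> c})" for e
  have "\<exists>x. \<forall>e\<in>{0<..<1}. x \<in> K e"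
  proof (rule chain_fip)
    fix e :: real assume "e \<in> {0<..<1}"
    then have e: "0 < e" "e < 1" by auto
    have "\<exists>x. \<forall>y\<in>convex hull F. g x (p e y) \<le> c"
      using F concave_imp_quasi_concave[OF conc_p[OF e]] cont_p[OF e] lsc[OF p[OF e]]
        inf_comp[OF p[OF e]] unique[OF p[OF e]] le[OF p[OF e]]
      by (rule finite_minimax_continuous[where g = "\<lambda>x y. g x (p e y)"])
    then obtain x where "x \<in> K e"
      by (auto simp: K_def)
    then show "K e \<noteq> {}" by blast
    have closed_K: "closed (K e)"
      unfolding K_def by (intro closed_INT ballI closed_sublevel lsc p e)
    then show "closed (K e)" .
    have "K e = {x. g x (p e b) \<le> c} \<inter> K e"
      using b by (auto simp: K_def)
    then show "compact (K e)"
      using compact_Int_closed[OF compact_sublevel[OF inf_comp[OF p[OF e b]]] closed_K] by metis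
  next
    fix d e :: real assume "d \<in> {0<..<1}" "e \<in> {0<..<1}" "d \<le> e"
    then have de: "0 < d" "d \<le> e" "e < 1" by auto
    \<comment> \<open>The solution of \<open>(1 - d) * m + d = e\<close>. With it
      \<open>p e y\<close> is the image under \<open>p d\<close> of a point of the hull: the copy
      for \<open>e\<close> lies in the copy for \<open>d\<close>, so \<open>K\<close>
      increases.\<close>
    define m where "m = (e - d) / (1 - d)"
    have m: "0 \<le> m" "m \<le> 1"
      using de by (auto simp: m_def field_simps)
    show "K d \<subseteq> K e"
    proof
      fix x assume x: "x \<in> K d"
      have "g x (p e y) \<le> c" if y: "y \<in> convex hull F" for y
      proof -
        have "(1 - d) * m = e - d"
          using de by (simp add: m_def)
        then have "(1 - d) * (1 - m) = 1 - e" "(1 - d) * m + d = e"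
          by (auto simp: algebra_simps)
        moreover have "p d ((1 - m) *\<^sub>R y + m *\<^sub>R b)
            = ((1 - d) * (1 - m)) *\<^sub>R y + ((1 - d) * m + d) *\<^sub>R b"
          by (simp only: p_def scaleR_add_right scaleR_add_left scaleR_scaleR add.assoc)
        ultimately have "p d ((1 - m) *\<^sub>R y + m *\<^sub>R b) = p e y"
          by (simp add: p_def)
        moreover have "(1 - m) *\<^sub>R y + m *\<^sub>R b \<in> convex hull F"
          using convexD_alt[OF convex_convex_hull y b m] .
        ultimately show ?thesis
          using x by (force simp: K_def)
      qed
      then show "x \<in> K e" by (simp add: K_def)
    qed
  qed auto
  then obtain x where x: "\<forall>e\<in>{0<..<1}. x \<in> K e" by blast
  have "g x y \<le> c" if y: "y \<in> convex hull F" for y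
  proof (rule tendsto_upperbound)
    \<comment> \<open>Concavity bounds \<open>g x (p e y)\<close> from below by this affine function
      of \<open>e\<close>, whose limit at \<open>0\<close> is \<open>g x y\<close> even if
      \<open>g x\<close> is discontinuous at \<open>y\<close>.\<close>
    have "((\<lambda>e. (1 - e) * g x y + e * g x b) \<longlongrightarrow> (1 - 0) * g x y + 0 * g x b) (at_right (0::real))"
      by (intro tendsto_intros)
    then show "((\<lambda>e. (1 - e) * g x y + e * g x b) \<longlongrightarrow> g x y) (at_right (0::real))" by simp
    have "(1 - e) * g x y + e * g x b \<le> c" if "e \<in> {0<..<1}" for e
    proof -
      have "(1 - e) * g x y + e * g x b \<le> g x (p e y)"
        using conc[of x] y b that by (simp add: concave_on_iff p_def)
      also have "\<dots> \<le> c"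
        using x that y by (force simp: K_def)
      finally show ?thesis .
    qed
    then show "\<forall>\<^sub>F e in at_right 0. (1 - e) * g x y + e * g x b \<le> c"
      using eventually_at_right_real[OF zero_less_one] by (rule eventually_mono[rotated])
  qed simp
  then show ?thesis by blast
qed

section \<open>Passage to an arbitrary convex set\<close>

text \<open>Here the axioms of a topological vector space enter: they turn continuity in the points
  of a hull into continuity in the weights.\<close>

lemma continuous_on_barycenter:
  fixes F :: "'b::real_tvs set"
  shows "continuous_on A (barycenter F)"
proof -
  have "((\<lambda>t. t y *\<^sub>R y) \<longlongrightarrow> u y *\<^sub>R y) (at u within A)" for u y
  proof -
    have "continuous_on UNIV (\<lambda>t::'b \<Rightarrow> real. t y)"
      by simp
    then have "((\<lambda>t::'b \<Rightarrow> real. t y) \<longlongrightarrow> u y) (at u within A)"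
      unfolding continuous_on_def by (meson UNIV_I subset_UNIV tendsto_within_subset)
    then have "LIM t at u within A. (t y, y) :> nhds (u y) \<times>\<^sub>F nhds y"
      by (intro filterlim_Pair tendsto_const)
    from filterlim_compose[OF tendsto_scaleR_Pair this] show ?thesis
      by simp
  qed
  then show ?thesis
    unfolding continuous_on_def barycenter_def by (intro ballI tendsto_sum) blast
qed

text \<open>The nontrivial half of the minimax equality, with \<open>c\<close> any upper bound of
  the minimum values. The hull of each finite subset of \<open>S\<close> yields the finite
  intersection property for the sublevel sets.\<close>

lemma minimax:
  fixes g :: "'a::topological_space \<Rightarrow> 'b::real_tvs \<Rightarrow> real"
  assumes S: "convex S"
    and g: "g \<in> class_B S"
    and lsc: "\<And>y. y \<in> S \<Longrightarrow> lower_semicont (\<lambda>x. g x y)"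
    and inf_comp: "\<And>y. y \<in> S \<Longrightarrow> inf_compact (\<lambda>x. g x y)"
    and unique: "\<And>y x z. y \<in> S \<Longrightarrow> global_min (\<lambda>x. g x y) x \<Longrightarrow>
      global_min (\<lambda>x. g x y) z \<Longrightarrow> x = z"
    and le: "\<And>y. y \<in> S \<Longrightarrow> \<exists>x. g x y \<le> c"
  shows "\<exists>x. \<forall>y\<in>S. g x y \<le> c"
proof (cases "S = {}")
  case False
  then obtain y0 where y0: "y0 \<in> S" by blast
  have fin: "\<exists>x. \<forall>y\<in>F. g x y \<le> c" if F: "finite F" "F \<noteq> {}" "F \<subseteq> S" for F
  proof -
    have sub: "convex hull F \<subseteq> S"
      using F S by (simp add: hull_minimal)
    note hyps = lsc[OF subsetD[OF sub]] inf_comp[OF subsetD[OF sub]] unique[OF subsetD[OF sub]]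
      le[OF subsetD[OF sub]]
    from g have "\<exists>x. \<forall>y\<in>convex hull F. g x y \<le> c"
      unfolding class_B_def mem_Collect_eq
    proof
      assume *: "\<forall>x. quasi_concave_on S (g x) \<and> continuous_on S (g x)"
      show ?thesis
      proof (rule finite_minimax_continuous[OF F(1,2) _ _ hyps])
        fix x
        show "quasi_concave_on (convex hull F) (g x)"
          using * by (blast intro: quasi_concave_on_subset[OF _ convex_convex_hull sub])
        show "continuous_on (weights F) (\<lambda>t. g x (barycenter F t))"
          using * sub convex_hull_eq_barycenter[OF F(1)]
          by (intro continuous_on_compose2[OF _ continuous_on_barycenter]) auto
      qed
    next
      assume *: "\<forall>x. concave_on S (g x)"
      show ?thesis
      proof (rule finite_minimax_concave[OF F(1,2) _ hyps])
        show "concave_on (convex hull F) (g x)" for x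
          using * sub unfolding concave_on_def
          by (meson convex_on_subset convex_convex_hull)
      qed
    qed
    then show ?thesis
      using hull_subset[of F convex] by blast
  qed
  have "{x. g x y0 \<le> c} \<inter> (\<Inter>y\<in>S. {x. g x y \<le> c}) \<noteq> {}"
  proof (rule compact_imp_fip_image)
    fix J assume "finite J" "J \<subseteq> S"
    then show "{x. g x y0 \<le> c} \<inter> (\<Inter>y\<in>J. {x. g x y \<le> c}) \<noteq> {}"
      \<comment> \<open>Inserting \<open>y0\<close> makes the finite set nonempty and includes the
        compact sublevel set.\<close>
      using fin[of "insert y0 J"] y0 by auto
  qed (auto intro: compact_sublevel[OF inf_comp[OF y0]] closed_sublevel lsc)
  then show ?thesis by blast
qed simp

section \<open>Stability under affine changes\<close>

lemma lower_semicont_affine: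
  assumes "lower_semicont h" "l > 0"
  shows "lower_semicont (\<lambda>x. h x / l + d)"
  unfolding lower_semicont_def
proof (intro allI impI)
  fix x c assume "c < h x / l + d"
  then have "(c - d) * l < h x"
    using assms(2) by (simp add: field_simps)
  with assms(1) have "\<forall>\<^sub>F z in nhds x. (c - d) * l < h z"
    by (simp add: lower_semicont_def)
  then show "\<forall>\<^sub>F z in nhds x. c < h z / l + d"
    by (rule eventually_mono) (use assms(2) in \<open>simp add: field_simps\<close>)
qed

lemma inf_compact_affine:
  assumes "inf_compact h" "l > 0"
  shows "inf_compact (\<lambda>x. h x / l + d)"
proof -
  have "(\<lambda>x. h x / l + d) -` {..r} = h -` {..(r - d) * l}" for r
    using assms(2) by (auto simp: field_simps)
  then show ?thesis
    using assms(1) by (simp add: inf_compact_def)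
qed

text \<open>Sums of quasi-concave functions need not be quasi-concave, but here the added term is
  constant in \<open>y\<close> and only shifts the level.\<close>

lemma class_B_add:
  assumes "g \<in> class_B Y" "convex S" "S \<subseteq> Y"
  shows "(\<lambda>x y. g x y + d x) \<in> class_B S"
proof -
  have "quasi_concave_on S (\<lambda>y. g x y + d x)" if "quasi_concave_on Y (g x)" for x
  proof -
    have "{y \<in> S. r \<le> g x y + d x} = {y \<in> S. r - d x \<le> g x y}" for r by auto
    then show ?thesis
      using quasi_concave_on_subset[OF that assms(2,3)] by (simp add: quasi_concave_on_def)
  qed
  moreover have "continuous_on S (\<lambda>y. g x y + d x)" if "continuous_on Y (g x)" for x
    using continuous_on_subset[OF that assms(3)] by (intro continuous_intros)
  moreover have "concave_on S (\<lambda>y. g x y + d x)" if "concave_on Y (g x)" for x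
  proof -
    have "concave_on S (g x)"
      using that assms(2,3) convex_on_subset unfolding concave_on_def by blast
    then show ?thesis
      by (intro concave_on_add) (simp_all add: concave_on_const assms)
  qed
  ultimately show ?thesis
    using assms(1) unfolding class_B_def by blast
qed

section \<open>Bounded perturbation of the minimax equality\<close>

theorem theorem1:
  fixes Y S :: "'b::{real_tvs, t2_space} set"
    and f :: "'a::topological_space \<Rightarrow> 'b \<Rightarrow> real"
    and \<psi> :: "'b \<Rightarrow> real"
    and \<phi> :: "'a \<Rightarrow> real"
    and l :: real
  assumes "convex Y"
    and "(\<lambda>x y. f x y + \<psi> y) \<in> class_B Y"
    and "alpha Y (\<lambda>x y. f x y + \<psi> y) < beta Y (\<lambda>x y. f x y + \<psi> y)"
    and "convex S" and "S \<subseteq> Y" and "S \<in> family_C Y (\<lambda>x y. f x y + \<psi> y)"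
    and "bounded (range \<phi>)"
    and "l > 0"
    and "(\<lambda>x y. l * f x y + \<phi> x) \<in> class_A S"
    and "ereal l > ereal (2 * (SUP x. \<bar>\<phi> x\<bar>)) /
           (beta Y (\<lambda>x y. f x y + \<psi> y) - alpha Y (\<lambda>x y. f x y + \<psi> y))"
  shows "\<exists>y\<in>S. \<exists>x1 x2. x1 \<noteq> x2 \<and>
           global_min (\<lambda>x. l * f x y + \<phi> x) x1 \<and>
           global_min (\<lambda>x. l * f x y + \<phi> x) x2"
proof (rule ccontr)
  assume no_two: "\<not> ?thesis"
  define G where "G x y = f x y + \<psi> y" for x y
  \<comment> \<open>For fixed \<open>y\<close> this is \<open>l * f x y + \<phi> x\<close> divided
    by \<open>l\<close> plus a constant, with the same minimum points; for fixed \<open>x\<close> it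
    is \<open>G x\<close> plus a constant, which preserves the concavity class.\<close>
  define g where "g x y = G x y + \<phi> x / l" for x y
  define M where "M = (SUP x. \<bar>\<phi> x\<bar>)"
  note hyps = assms[folded G_def]
  have "bdd_above (range (\<lambda>x. \<bar>\<phi> x\<bar>))"
    using assms(7) by (auto simp: bounded_iff bdd_above_def)
  then have M: "\<bar>\<phi> x\<bar> \<le> M" for x
    unfolding M_def by (intro cSUP_upper) auto
  have M_div: "\<phi> x / l \<le> M / l" "- (\<phi> x / l) \<le> M / l" for x
    using M[of x] \<open>l > 0\<close> by (auto simp: field_simps)
  have g_eq: "g x y = (l * f x y + \<phi> x) / l + \<psi> y" for x y
    using \<open>l > 0\<close> by (simp add: g_def G_def field_simps)
  have lsc: "lower_semicont (\<lambda>x. g x y)" and inf_comp: "inf_compact (\<lambda>x. g x y)"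
    if "y \<in> S" for y
    unfolding g_eq using that assms(9) \<open>l > 0\<close>
    by (auto simp: class_A_def intro: lower_semicont_affine inf_compact_affine)
  have "global_min (\<lambda>x. g x y) x \<longleftrightarrow> global_min (\<lambda>x. l * f x y + \<phi> x) x" for x y
    using \<open>l > 0\<close> by (simp add: global_min_def g_eq divide_le_cancel)
  then have unique: "x = z"
    if "y \<in> S" "global_min (\<lambda>x. g x y) x" "global_min (\<lambda>x. g x y) z" for x y z
    using that no_two by blast
  have g_B: "g \<in> class_B S"
    unfolding g_def using hyps(2) assms(4,5) by (rule class_B_add)
  have beta_S: "beta Y G = (INF x. SUP y\<in>S. ereal (G x y))"
    using hyps(6) by (simp add: family_C_def beta_def)
  have "S \<noteq> {}"
  proof
    assume "S = {}"
    \<comment> \<open>The supremum over the empty set is the bottom of the extended reals.\<close>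
    then have "beta Y G = - \<infinity>"
      by (simp add: beta_S bot_ereal_def)
    with hyps(3) show False by simp
  qed
  \<comment> \<open>Since \<open>g\<close> and \<open>G\<close> differ by at most
    \<open>M / l\<close>, the minimum of \<open>g\<close> at \<open>y\<close> exceeds the infimum of
    \<open>G\<close> there by at most \<open>M / l\<close>.\<close>
  have attained: "\<exists>x. ereal (g x y) \<le> alpha Y G + ereal (M / l)" if y: "y \<in> S" for y
  proof -
    obtain x where x: "\<And>z. g x y \<le> g z y"
      using global_min_exists[OF lsc[OF y] inf_comp[OF y]] by (auto simp: global_min_def)
    have "ereal (g x y - M / l) \<le> (INF z. ereal (G z y))"
    proof (rule INF_greatest)
      fix z
      show "ereal (g x y - M / l) \<le> ereal (G z y)"
        using x[of z] M_div[of z] by (simp add: g_def)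
    qed
    also have "\<dots> \<le> alpha Y G"
      unfolding alpha_def using y assms(5) by (intro SUP_upper) auto
    finally have "ereal (g x y - M / l) + ereal (M / l) \<le> alpha Y G + ereal (M / l)"
      by (rule add_right_mono)
    then show ?thesis by auto
  qed
  \<comment> \<open>The strict inequality with \<open>beta\<close> excludes plus infinity, and
    \<open>attained\<close> at a point of \<open>S\<close> excludes minus infinity.\<close>
  obtain a where a: "alpha Y G = ereal a"
  proof (cases "alpha Y G")
    case MInf
    obtain y where "y \<in> S" using \<open>S \<noteq> {}\<close> by blast
    from attained[OF this] show ?thesis by (simp add: MInf)
  qed (use hyps(3) in auto)
  have "\<exists>x. \<forall>y\<in>S. g x y \<le> a + M / l"
    using assms(4) g_B lsc inf_comp unique
  proof (rule minimax)
    show "\<exists>x. g x y \<le> a + M / l" if "y \<in> S" for y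
      using attained[OF that] by (simp add: a)
  qed
  then obtain x where x: "\<And>y. y \<in> S \<Longrightarrow> g x y \<le> a + M / l" by blast
  \<comment> \<open>Returning from \<open>g\<close> to \<open>G\<close> costs a second
    \<open>M / l\<close>, whence the factor \<open>2\<close>.\<close>
  have "beta Y G \<le> (SUP y\<in>S. ereal (G x y))"
    unfolding beta_S by (rule INF_lower) simp
  also have "\<dots> \<le> ereal (a + 2 * M / l)"
  proof (rule SUP_least)
    fix y assume "y \<in> S"
    then show "ereal (G x y) \<le> ereal (a + 2 * M / l)"
      using x[of y] M_div[of x] by (simp add: g_def)
  qed
  finally have beta_le: "beta Y G \<le> ereal (a + 2 * M / l)" .
  then obtain b where b: "beta Y G = ereal b"
    using hyps(3) by (cases "beta Y G") auto
  have "a < b" "b \<le> a + 2 * M / l"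
    using hyps(3) beta_le by (auto simp: a b)
  \<comment> \<open>Both extremal values are real with \<open>a < b\<close>, so the extended
    quotient is ordinary division and forces \<open>2 * M / l < b - a\<close>.\<close>
  moreover have "2 * M / (b - a) < l"
    using hyps(10) \<open>a < b\<close> by (simp add: a b M_def)
  ultimately show False
    using \<open>l > 0\<close> by (simp add: field_simps)
qed

end
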